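(* Let $G$ be a connected graph with at least $2$ vertices and $H$ a connected graph. Then \[F(G+_T H)=8|V(H)|F(G)+|V(G)|F(H)+24|E(H)|M_1(G)+12|E(G)|M_1(H)+|V(H)|\xi_4(G)+3|V(H)|\,\mathrm{ReZM}(G).\]
   Context: All graphs are finite, simple and undirected; $d_G(v)$ denotes degree. $F(G)=\sum_{v\in V(G)}d_G(v)^3$, $M_1(G)=\sum_{v\in V(G)}d_G(v)^2$, $\xi_4(G)=\sum_{v\in V(G)}d_G(v)^4$, and $\mathrm{ReZM}(G)=\sum_{uv\in E(G)}d_G(u)d_G(v)[d_G(u)+d_G(v)]$. The total graph $T(G)$ has vertex set $V(G)\cup E(G)$, two of these elements being adjacent if and only if they are adjacent or incident in $G$. The $T$-sum $G+_T H$ is the graph with vertex set $(V(G)\cup E(G))\times V(H)$ in which $(u,v)$ and $(u',v')$ are adjacent if and only if [$u=u'\in V(G)$ and $vv'\in E(H)$] or [$v=v'$ and $uu'\in E(T(G))$]. *)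

theory Defs
  imports "Graph_Theory.Graph_Theory"
begin

text \<open>
  A finite simple undirected graph is a \<^locale>\<open>pair_graph\<close>: a finite, loop-free, symmetric
  digraph whose arcs are ordered pairs.  Each undirected edge \<open>uv\<close> thus occurs as the two arcs
  \<open>(u,v)\<close> and \<open>(v,u)\<close>, so edges proper are recovered as unordered pairs.
\<close>

definition edge_set :: "'a pair_pre_digraph \<Rightarrow> 'a set set" where
  "edge_set G = {{u, v} | u v. (u, v) \<in> parcs G}"

definition vdeg :: "'a pair_pre_digraph \<Rightarrow> 'a \<Rightarrow> nat" where
  "vdeg G v = card {e \<in> edge_set G. v \<in> e}"

definition forgotten_index :: "'a pair_pre_digraph \<Rightarrow> nat" where
  "forgotten_index G = (\<Sum>v\<in>pverts G. vdeg G v ^ 3)"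

definition first_zagreb :: "'a pair_pre_digraph \<Rightarrow> nat" where
  "first_zagreb G = (\<Sum>v\<in>pverts G. vdeg G v ^ 2)"

definition xi4 :: "'a pair_pre_digraph \<Rightarrow> nat" where
  "xi4 G = (\<Sum>v\<in>pverts G. vdeg G v ^ 4)"

text \<open>
  For an edge \<open>e = {u,v}\<close> with \<open>u \<noteq> v\<close> the summand below is \<open>d(u) d(v) (d(u) + d(v))\<close>;
  see \<open>ReZM_summand\<close>.
\<close>

definition ReZM :: "'a pair_pre_digraph \<Rightarrow> nat" where
  "ReZM G = (\<Sum>e\<in>edge_set G. (\<Prod>u\<in>e. vdeg G u) * (\<Sum>u\<in>e. vdeg G u))"

text \<open>The disjoint union of vertices and edges is the sum type, with \<open>Inl\<close> marking vertices.\<close>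

definition total_graph :: "'a pair_pre_digraph \<Rightarrow> ('a + 'a set) pair_pre_digraph" where
  "total_graph G = \<lparr> pverts = pverts G <+> edge_set G,
     parcs = {(Inl u, Inl v) | u v. (u, v) \<in> parcs G}
       \<union> {(Inr e, Inr f) | e f. e \<in> edge_set G \<and> f \<in> edge_set G \<and> e \<noteq> f \<and> e \<inter> f \<noteq> {}}
       \<union> {(Inl u, Inr e) | u e. e \<in> edge_set G \<and> u \<in> e}
       \<union> {(Inr e, Inl u) | u e. e \<in> edge_set G \<and> u \<in> e} \<rparr>"

definition T_sum ::
  "'a pair_pre_digraph \<Rightarrow> 'b pair_pre_digraph \<Rightarrow> (('a + 'a set) \<times> 'b) pair_pre_digraph" where
  "T_sum G H = \<lparr> pverts = (pverts G <+> edge_set G) \<times> pverts H,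
     parcs = {((x, v), (x', v')) | x v x' v'.
       x \<in> pverts G <+> edge_set G \<and> x' \<in> pverts G <+> edge_set G \<and>
       v \<in> pverts H \<and> v' \<in> pverts H \<and>
       (x = x' \<and> x \<in> Inl ` pverts G \<and> (v, v') \<in> parcs H \<or>
        v = v' \<and> (x, x') \<in> parcs (total_graph G))} \<rparr>"

lemma (in pair_graph) ReZM_summand:
  assumes "(u, v) \<in> parcs G"
  shows "(\<Prod>w\<in>{u, v}. vdeg G w) * (\<Sum>w\<in>{u, v}. vdeg G w)
       = vdeg G u * vdeg G v * (vdeg G u + vdeg G v)"
  using assms no_loops by auto

lemma (in pair_graph) arcs_swap: "(u, v) \<in> parcs G \<Longrightarrow> (v, u) \<in> parcs G"
  using arcs_symmetric by blast

lemma (in pair_graph) finite_edge_set: "finite (edge_set G)"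
proof -
  have "edge_set G = (\<lambda>(u, v). {u, v}) ` parcs G"
    by (auto simp: edge_set_def)
  then show ?thesis using pair_finite_arcs by simp
qed

lemma (in pair_graph) vdeg_eq_out_degree: "vdeg G v = out_degree (with_proj G) v"
proof -
  have "bij_betw (\<lambda>a. {fst a, snd a}) (out_arcs (with_proj G) v) {e \<in> edge_set G. v \<in> e}"
    unfolding bij_betw_def
  proof
    show "inj_on (\<lambda>a. {fst a, snd a}) (out_arcs (with_proj G) v)"
      by (auto simp: inj_on_def out_arcs_def doubleton_eq_iff)
    show "(\<lambda>a. {fst a, snd a}) ` out_arcs (with_proj G) v = {e \<in> edge_set G. v \<in> e}"
      using arcs_swap by (force simp: out_arcs_def edge_set_def image_iff)
  qed
  then show ?thesis
    by (simp add: vdeg_def out_degree_def bij_betw_same_card)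
qed

lemma pair_graph_total_graph:
  assumes "pair_graph G" shows "pair_graph (total_graph G)"
proof -
  interpret pair_graph G by fact
  have fin: "finite (pverts (total_graph G))"
    using finite_edge_set by (simp add: total_graph_def)
  have sub: "parcs (total_graph G) \<subseteq> pverts (total_graph G) \<times> pverts (total_graph G)"
    using in_arcsD1 in_arcsD2 by (auto simp: total_graph_def edge_set_def)
  show ?thesis
  proof
    show "finite (parcs (total_graph G))"
      using sub fin by (meson finite_SigmaI finite_subset)
    show "symmetric (with_proj (total_graph G))"
      using arcs_swap by (auto simp: symmetric_def total_graph_def sym_def)
    show "fst e \<noteq> snd e" if "e \<in> parcs (total_graph G)" for e
      using that no_loops by (auto simp: total_graph_def)
  qed (use sub fin in auto)
qed

lemma pair_graph_T_sum:
  assumes "pair_graph G" "pair_graph H" shows "pair_graph (T_sum G H)"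
proof -
  interpret G: pair_graph G by fact
  interpret H: pair_graph H by fact
  interpret T: pair_graph "total_graph G" using assms(1) by (rule pair_graph_total_graph)
  have fin: "finite (pverts (T_sum G H))"
    using G.finite_edge_set by (simp add: T_sum_def)
  have sub: "parcs (T_sum G H) \<subseteq> pverts (T_sum G H) \<times> pverts (T_sum G H)"
    by (auto simp: T_sum_def)
  show ?thesis
  proof
    show "finite (parcs (T_sum G H))"
      using sub fin by (meson finite_SigmaI finite_subset)
    show "symmetric (with_proj (T_sum G H))"
      using H.arcs_swap T.arcs_swap by (auto simp: symmetric_def T_sum_def sym_def)
    show "fst e \<noteq> snd e" if "e \<in> parcs (T_sum G H)" for e
      using that by (auto simp: T_sum_def dest: H.no_loops T.no_loops)
  qed (use sub fin in auto)
qed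

end

theory Submission
  imports Defs
begin

text \<open>
  In \<open>G +\<^sub>T H\<close> a pair \<open>(u, v)\<close> with \<open>u\<close> a vertex has degree \<open>2 d\<^sub>G(u) + d\<^sub>H(v)\<close>, while
  \<open>(e, v)\<close> with \<open>e = ab\<close> an edge has degree \<open>2 + (d\<^sub>G(a) - 1) + (d\<^sub>G(b) - 1) = d\<^sub>G(a) + d\<^sub>G(b)\<close>.
  Expanding the cubes of the first kind with the handshake lemma gives the terms in \<open>F\<close> and
  \<open>M\<^sub>1\<close>.  For the second kind,
  \<open>(x + y)\<^sup>3 = x\<^sup>3 + y\<^sup>3 + 3 x y (x + y)\<close>, and summing \<open>d\<^sub>G(a)\<^sup>3 + d\<^sub>G(b)\<^sup>3\<close> over edges is summing
  \<open>d\<^sub>G(a)\<^sup>4\<close> over vertices.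
\<close>

context pair_graph
begin

lemma edge_setE:
  assumes "e \<in> edge_set G"
  obtains a b where "e = {a, b}" "a \<noteq> b" "(a, b) \<in> parcs G" "a \<in> pverts G" "b \<in> pverts G"
  using assms no_loops in_arcsD1 in_arcsD2 unfolding edge_set_def by fastforce

lemma finite_neighbours: "finite {w. (v, w) \<in> parcs G}"
proof (rule finite_subset)
  show "{w. (v, w) \<in> parcs G} \<subseteq> pverts G"
    using in_arcsD2 by auto
qed simp

text \<open>Mapping a neighbour \<open>w\<close> to the edge \<open>{v, w}\<close> is a bijection
  onto the edges at \<open>v\<close>. Degrees in \<open>total_graph\<close> and \<open>T_sum\<close>
  can then be read off from neighbourhoods, without handling their edge sets.\<close>

lemma vdeg_eq_card_neighbours: "vdeg G v = card {w. (v, w) \<in> parcs G}"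
proof -
  have "{e \<in> edge_set G. v \<in> e} = (\<lambda>w. {v, w}) ` {w. (v, w) \<in> parcs G}"
    using arcs_swap by (auto simp: edge_set_def image_iff)
  moreover have "inj_on (\<lambda>w. {v, w}) {w. (v, w) \<in> parcs G}"
    by (auto simp: inj_on_def doubleton_eq_iff)
  ultimately show ?thesis
    by (simp add: vdeg_def card_image)
qed

text \<open>Double counting of incident vertex-edge pairs: the term \<open>f v\<close> occurs once
  for each of the \<open>vdeg G v\<close> edges at \<open>v\<close>.\<close>

lemma sum_edges_endpoints:
  fixes f :: "'a \<Rightarrow> nat"
  shows "(\<Sum>e\<in>edge_set G. \<Sum>u\<in>e. f u) = (\<Sum>v\<in>pverts G. vdeg G v * f v)"
proof -
  have "(\<Sum>e\<in>edge_set G. \<Sum>u\<in>e. f u) = (\<Sum>e\<in>edge_set G. \<Sum>u | u \<in> pverts G \<and> u \<in> e. f u)"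
  proof (rule sum.cong[OF refl])
    fix e assume "e \<in> edge_set G"
    then have "e = {u. u \<in> pverts G \<and> u \<in> e}"
      by (auto elim: edge_setE)
    then show "(\<Sum>u\<in>e. f u) = (\<Sum>u | u \<in> pverts G \<and> u \<in> e. f u)"
      by simp
  qed
  also have "\<dots> = (\<Sum>v\<in>pverts G. \<Sum>e | e \<in> edge_set G \<and> v \<in> e. f v)"
    by (rule sum.swap_restrict) (simp_all add: finite_edge_set)
  finally show ?thesis
    by (simp add: vdeg_def)
qed

lemma sum_vdeg: "(\<Sum>v\<in>pverts G. vdeg G v) = 2 * card (edge_set G)"
proof -
  have "card e = 2" if "e \<in> edge_set G" for e
    using that by (auto elim: edge_setE)
  then show ?thesis
    using sum_edges_endpoints[of "\<lambda>_. 1"] by simp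
qed

lemma sum_edges_cube:
  "(\<Sum>e\<in>edge_set G. (\<Sum>u\<in>e. vdeg G u) ^ 3) = xi4 G + 3 * ReZM G"
proof -
  have "(\<Sum>e\<in>edge_set G. (\<Sum>u\<in>e. vdeg G u) ^ 3)
      = (\<Sum>e\<in>edge_set G. (\<Sum>u\<in>e. vdeg G u ^ 3)
          + 3 * ((\<Prod>u\<in>e. vdeg G u) * (\<Sum>u\<in>e. vdeg G u)))"
    by (rule sum.cong[OF refl])
      (auto elim!: edge_setE simp: power3_eq_cube algebra_simps)
  also have "\<dots> = (\<Sum>v\<in>pverts G. vdeg G v * vdeg G v ^ 3) + 3 * ReZM G"
    by (simp add: sum.distrib sum_edges_endpoints ReZM_def sum_distrib_left)
  also have "(\<Sum>v\<in>pverts G. vdeg G v * vdeg G v ^ 3) = xi4 G"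
    by (simp add: xi4_def power_numeral_reduce)
  finally show ?thesis .
qed

text \<open>A vertex meets its neighbours and its incident edges, and there are
  \<open>vdeg G u\<close> of each.\<close>

lemma vdeg_total_graph_Inl:
  assumes "u \<in> pverts G"
  shows "vdeg (total_graph G) (Inl u) = 2 * vdeg G u"
proof -
  interpret T: pair_graph "total_graph G"
    by (rule pair_graph_total_graph) unfold_locales
  have "{x. (Inl u, x) \<in> parcs (total_graph G)}
      = {w. (u, w) \<in> parcs G} <+> {e \<in> edge_set G. u \<in> e}"
    by (auto simp: total_graph_def)
  then show ?thesis
    using finite_edge_set finite_neighbours
    by (simp add: T.vdeg_eq_card_neighbours card_Plus vdeg_eq_card_neighbours[symmetric])
      (simp add: vdeg_def)
qed

lemma vdeg_total_graph_Inr: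
  assumes "e \<in> edge_set G"
  shows "vdeg (total_graph G) (Inr e) = (\<Sum>u\<in>e. vdeg G u)"
proof -
  interpret T: pair_graph "total_graph G"
    by (rule pair_graph_total_graph) unfold_locales
  obtain a b where e: "e = {a, b}" "a \<noteq> b"
    using assms by (rule edge_setE)
  define E where "E = (\<lambda>v. {f \<in> edge_set G. v \<in> f} - {e})"
  have fin: "finite (E v)" for v
    using finite_edge_set by (simp add: E_def)
  \<comment> \<open>The successor form avoids truncated subtraction. The two successors, for
    \<open>a\<close> and \<open>b\<close>, are later matched by the two endpoints of
    \<open>e\<close>, which are neighbours of \<open>Inr e\<close>.\<close>
  have card_E: "Suc (card (E v)) = vdeg G v" if "v \<in> e" for v
    unfolding E_def vdeg_def using assms that finite_edge_set
    by (intro card_Suc_Diff1) auto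
  \<comment> \<open>An edge containing both \<open>a\<close> and \<open>b\<close> is
    \<open>e\<close> itself, which both sets exclude.\<close>
  have "E a \<inter> E b = {}"
    using e by (auto simp: E_def elim!: edge_setE)
  then have "card (E a \<union> E b) = card (E a) + card (E b)"
    by (simp add: card_Un_disjoint fin)
  moreover have "{x. (Inr e, x) \<in> parcs (total_graph G)} = e <+> (E a \<union> E b)"
    using assms e by (auto simp: total_graph_def E_def)
  ultimately show ?thesis
    using e fin card_E[of a] card_E[of b]
    by (simp add: T.vdeg_eq_card_neighbours card_Plus)
qed

end

lemma vdeg_T_sum_Inl:
  assumes "pair_graph G" "pair_graph H" "u \<in> pverts G" "v \<in> pverts H"
  shows "vdeg (T_sum G H) (Inl u, v) = 2 * vdeg G u + vdeg H v"
proof -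
  interpret G: pair_graph G by fact
  interpret H: pair_graph H by fact
  interpret T: pair_graph "total_graph G" using assms(1) by (rule pair_graph_total_graph)
  interpret S: pair_graph "T_sum G H" using assms(1,2) by (rule pair_graph_T_sum)
  \<comment> \<open>\<open>?A\<close> collects the neighbours along the copy of \<open>H\<close> at
    \<open>u\<close>, \<open>?B\<close> those within the copy of the total graph at
    \<open>v\<close>. A common element would give a loop at \<open>v\<close> in
    \<open>H\<close>.\<close>
  let ?A = "{Inl u} \<times> {w. (v, w) \<in> parcs H}"
  let ?B = "{x. (Inl u, x) \<in> parcs (total_graph G)} \<times> {v}"
  have "x \<in> pverts G <+> edge_set G" if "(Inl u, x) \<in> parcs (total_graph G)" for x
    using T.in_arcsD2[OF that] by (simp add: total_graph_def)
  then have "{y. ((Inl u, v), y) \<in> parcs (T_sum G H)} = ?A \<union> ?B"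
    using assms(3,4) H.in_arcsD2 by (auto simp: T_sum_def)
  moreover have "?A \<inter> ?B = {}"
    using H.no_loops by fastforce
  ultimately have "vdeg (T_sum G H) (Inl u, v) = card ?A + card ?B"
    using H.finite_neighbours T.finite_neighbours
    by (simp add: S.vdeg_eq_card_neighbours card_Un_disjoint)
  then show ?thesis
    using G.vdeg_total_graph_Inl[OF assms(3)]
    by (simp add: card_cartesian_product H.vdeg_eq_card_neighbours T.vdeg_eq_card_neighbours)
qed

text \<open>Arcs of \<open>H\<close> are copied only at vertices of \<open>G\<close>, so all
  neighbours of \<open>(Inr e, v)\<close> lie in layer \<open>v\<close> and the degree is that of
  \<open>Inr e\<close> in the total graph.\<close>

lemma vdeg_T_sum_Inr:
  assumes "pair_graph G" "pair_graph H" "e \<in> edge_set G" "v \<in> pverts H"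
  shows "vdeg (T_sum G H) (Inr e, v) = (\<Sum>u\<in>e. vdeg G u)"
proof -
  interpret G: pair_graph G by fact
  interpret T: pair_graph "total_graph G" using assms(1) by (rule pair_graph_total_graph)
  interpret S: pair_graph "T_sum G H" using assms(1,2) by (rule pair_graph_T_sum)
  have "x \<in> pverts G <+> edge_set G" if "(Inr e, x) \<in> parcs (total_graph G)" for x
    using T.in_arcsD2[OF that] by (simp add: total_graph_def)
  then have "{y. ((Inr e, v), y) \<in> parcs (T_sum G H)}
      = {x. (Inr e, x) \<in> parcs (total_graph G)} \<times> {v}"
    using assms(3,4) by (auto simp: T_sum_def)
  then show ?thesis
    using G.vdeg_total_graph_Inr[OF assms(3)]
    by (simp add: card_cartesian_product S.vdeg_eq_card_neighbours T.vdeg_eq_card_neighbours)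
qed

lemma sum_cube_vertex_pairs:
  assumes "pair_graph G" "pair_graph H"
  shows "(\<Sum>u\<in>pverts G. \<Sum>v\<in>pverts H. (2 * vdeg G u + vdeg H v) ^ 3) =
      8 * card (pverts H) * forgotten_index G
    + card (pverts G) * forgotten_index H
    + 24 * card (edge_set H) * first_zagreb G
    + 12 * card (edge_set G) * first_zagreb H"
proof -
  interpret G: pair_graph G by fact
  interpret H: pair_graph H by fact
  have "(2 * x + y) ^ 3 = 8 * x ^ 3 + y ^ 3 + 12 * (x ^ 2 * y) + 6 * (x * y ^ 2)" for x y :: nat
    by (simp add: power3_eq_cube power2_eq_square algebra_simps)
  then have "(\<Sum>u\<in>pverts G. \<Sum>v\<in>pverts H. (2 * vdeg G u + vdeg H v) ^ 3) =
      8 * card (pverts H) * forgotten_index G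
    + card (pverts G) * forgotten_index H
    + 12 * (first_zagreb G * (\<Sum>v\<in>pverts H. vdeg H v))
    + 6 * ((\<Sum>u\<in>pverts G. vdeg G u) * first_zagreb H)"
    by (simp add: sum.distrib sum_product forgotten_index_def first_zagreb_def
        flip: sum_distrib_left)
  \<comment> \<open>The handshake lemma doubles the coefficients 12 and 6 of the mixed
    terms.\<close>
  then show ?thesis
    by (simp add: G.sum_vdeg H.sum_vdeg)
qed

theorem theorem5:
  fixes G :: "'a pair_pre_digraph" and H :: "'b pair_pre_digraph"
  assumes "pair_graph G" and "Digraph_Component.connected (with_proj G)"
    and "card (pverts G) \<ge> 2"
    and "pair_graph H" and "Digraph_Component.connected (with_proj H)"
  shows "forgotten_index (T_sum G H) =
      8 * card (pverts H) * forgotten_index G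
    + card (pverts G) * forgotten_index H
    + 24 * card (edge_set H) * first_zagreb G
    + 12 * card (edge_set G) * first_zagreb H
    + card (pverts H) * xi4 G
    + 3 * card (pverts H) * ReZM G"
proof -
  interpret G: pair_graph G by fact
  interpret H: pair_graph H by fact
  have "forgotten_index (T_sum G H)
      = (\<Sum>x\<in>pverts G <+> edge_set G. \<Sum>v\<in>pverts H. vdeg (T_sum G H) (x, v) ^ 3)"
    by (simp add: forgotten_index_def T_sum_def sum.cartesian_product)
  also have "\<dots> = (\<Sum>u\<in>pverts G. \<Sum>v\<in>pverts H. vdeg (T_sum G H) (Inl u, v) ^ 3)
      + (\<Sum>e\<in>edge_set G. \<Sum>v\<in>pverts H. vdeg (T_sum G H) (Inr e, v) ^ 3)"
    by (simp add: sum.Plus G.finite_edge_set)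
  \<comment> \<open>The degree of \<open>(Inr e, v)\<close> does not depend on \<open>v\<close>, so
    the sum over \<open>v\<close> becomes the factor \<open>card (pverts H)\<close>.\<close>
  also have "\<dots> = (\<Sum>u\<in>pverts G. \<Sum>v\<in>pverts H. (2 * vdeg G u + vdeg H v) ^ 3)
      + card (pverts H) * (\<Sum>e\<in>edge_set G. (\<Sum>u\<in>e. vdeg G u) ^ 3)"
    using assms(1,4) by (simp add: vdeg_T_sum_Inl vdeg_T_sum_Inr sum_distrib_left)
  finally show ?thesis
    by (simp add: sum_cube_vertex_pairs[OF assms(1,4)] G.sum_edges_cube distrib_left)
qed

end
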